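(* Let $G$ be a CHART group (compact Hausdorff admissible right topological group). Then the following conditions are equivalent: (1) $G$ is metrizable; (2) $G$ is first-countable; (3) $G$ is Fréchet; (4) $G$ has countable tightness; (5) $G$ has countable $\pi$-character.
   Context: A group $G$ with a topology is called right topological if all right shifts $\rho_h: G\to G$, $g\mapsto gh$ ($h\in G$), are continuous. The topological center $\Lambda(G)$ is the set of all $g\in G$ for which the left shift $\lambda_g: G\to G$, $h\mapsto gh$, is continuous. A right topological group $G$ is admissible if $\Lambda(G)$ is dense in $G$. A CHART group is a compact Hausdorff admissible right topological group. A space $X$ is Fréchet (Fréchet–Urysohn) if whenever $A\subset X$ and $x\in\overline{A}$ there is a sequence of points of $A$ converging to $x$. $X$ has countable tightness if whenever $A\subset X$ and $x\in\overline{A}$ there is a countable $M\subset A$ with $x\in\overline{M}$. A family $\mathcal P$ of nonempty open subsets of $X$ is a $\pi$-base at $x\in X$ if for every neighborhood $U$ of $x$ there is $V\in\mathcal P$ with $V\subset U$; $X$ has countable $\pi$-character if every point of $X$ has a countable $\pi$-base. *)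

theory Defs
  imports "HOL-Analysis.Analysis" "HOL-Algebra.Group"
begin

text \<open>Only the right shifts are required to be continuous: neither joint continuity of the
  multiplication nor continuity of the inverse is assumed.\<close>

locale right_topological_group = group G
  for G :: "('a, 'b) monoid_scheme" (structure) and X :: "'a topology" +
  assumes topspace_eq_carrier: "topspace X = carrier G"
    and continuous_right_shift: "h \<in> carrier G \<Longrightarrow> continuous_map X X (\<lambda>g. g \<otimes> h)"

definition topological_center :: "('a, 'b) monoid_scheme \<Rightarrow> 'a topology \<Rightarrow> 'a set" where
  "topological_center G X = {g \<in> carrier G. continuous_map X X (\<lambda>h. g \<otimes>\<^bsub>G\<^esub> h)}"

locale admissible_right_topological_group = right_topological_group +
  assumes topological_center_dense: "X closure_of topological_center G X = topspace X"

locale CHART_group = admissible_right_topological_group +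
  assumes compact: "compact_space X"
    and Hausdorff: "Hausdorff_space X"

definition Frechet_space :: "'a topology \<Rightarrow> bool" where
  "Frechet_space X \<longleftrightarrow>
    (\<forall>A x. A \<subseteq> topspace X \<and> x \<in> X closure_of A \<longrightarrow>
      (\<exists>s :: nat \<Rightarrow> 'a. range s \<subseteq> A \<and> limitin X s x sequentially))"

definition countable_tightness :: "'a topology \<Rightarrow> bool" where
  "countable_tightness X \<longleftrightarrow>
    (\<forall>A x. A \<subseteq> topspace X \<and> x \<in> X closure_of A \<longrightarrow>
      (\<exists>M. M \<subseteq> A \<and> countable M \<and> x \<in> X closure_of M))"

text \<open>Members of a \<open>\<pi>\<close>-base at \<open>x\<close> need not contain \<open>x\<close>. As in the library's
  \<^const>\<open>first_countable\<close>, it suffices to test open neighbourhoods of \<open>x\<close>.\<close>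

definition pi_base_at :: "'a topology \<Rightarrow> 'a \<Rightarrow> 'a set set \<Rightarrow> bool" where
  "pi_base_at X x \<P> \<longleftrightarrow>
    (\<forall>V\<in>\<P>. openin X V \<and> V \<noteq> {}) \<and>
    (\<forall>U. openin X U \<and> x \<in> U \<longrightarrow> (\<exists>V\<in>\<P>. V \<subseteq> U))"

definition countable_pi_character :: "'a topology \<Rightarrow> bool" where
  "countable_pi_character X \<longleftrightarrow>
    (\<forall>x\<in>topspace X. \<exists>\<P>. countable \<P> \<and> pi_base_at X x \<P>)"

end

theory Submission
  imports Defs
begin

text \<open>Metrizability implies first countability, first countability implies the Frechet property,
  and this implies countable tightness; these are elementary facts about arbitrary spaces. Two
  steps are left, and only the second uses the group.

  In a compact Hausdorff space countable tightness implies countable \<open>\<pi>\<close>-character, a theorem of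
  Shapirovskii. A point \<open>p\<close> without a countable \<open>\<pi>\<close>-base has, for any countably many nonempty
  zero sets of continuous functions, an open neighbourhood containing none of them: otherwise the
  sets \<open>{\<bar>h\<bar> < 1/n}\<close>, which by compactness shrink to the zero set of \<open>h\<close>, would form a countable
  \<open>\<pi>\<close>-base (\<open>function_escaping_zero_sets\<close>). This allows a recursion of length \<open>\<omega>\<^sub>1\<close> that
  produces functions \<open>f\<^sub>i\<close> vanishing at \<open>p\<close> together with points \<open>x\<^sub>i\<close> such that \<open>f\<^sub>j(x\<^sub>i)\<close> is \<open>0\<close>
  for \<open>j \<le> i\<close> and \<open>1\<close> for \<open>j > i\<close>, that is, a free sequence. Compactness gives a point \<open>y\<close> in the
  closure of all \<open>x\<^sub>i\<close> at which every \<open>f\<^sub>i\<close> vanishes. A countable set of \<open>x\<^sub>i\<close> is bounded by some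
  index \<open>j\<close>, so \<open>f\<^sub>j\<close> is \<open>1\<close> on its closure, which therefore misses \<open>y\<close>.

  In a CHART group a countable \<open>\<pi>\<close>-base \<open>\<P>\<close> at the identity already gives a metric. The
  topological center meets every translate of a nonempty open set, so by compactness finitely many
  elements \<open>l\<close> of the center move every point of the group into a given \<open>P \<in> \<P>\<close>; collecting them
  for all \<open>P\<close> yields a countable dense subset \<open>H\<close> of the center
  (\<open>countable_dense_subset_of_center\<close>). Choose for each \<open>P\<close> a nonzero continuous \<open>f\<^sub>P\<close>
  supported in \<open>P\<close>. The countably many functions \<open>h \<mapsto> f\<^sub>P(l h)\<close> with \<open>l \<in> H\<close> are continuous because
  \<open>l\<close> lies in the center, and they separate points. Indeed, if they agree at \<open>x\<close> and \<open>y\<close>, then by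
  density of \<open>H\<close> and continuity of right shifts \<open>f\<^sub>P(g x) = f\<^sub>P(g y)\<close> for all \<open>g\<close>, which makes every
  \<open>f\<^sub>P\<close> invariant under right translation by \<open>z = x\<^sup>-\<^sup>1 y\<close>. If \<open>z\<close> were not the identity, its right
  shift would move some neighbourhood of the identity off itself; this neighbourhood contains some
  \<open>P\<close>, and a function living on \<open>P\<close> cannot be invariant (\<open>eq_one_of_invariance\<close>). Hence the compact
  space embeds into a countable power of the real line.\<close>

section \<open>Sequences and closures\<close>

lemma first_countable_imp_Frechet_space:
  assumes "first_countable X"
  shows "Frechet_space X"
  unfolding Frechet_space_def
proof (intro allI impI, elim conjE)
  fix A x
  assume A: "A \<subseteq> topspace X" and x: "x \<in> X closure_of A"
  have xX: "x \<in> topspace X"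
    using x by (simp add: in_closure_of)
  obtain \<B> where \<B>: "countable \<B>" "\<And>V. V \<in> \<B> \<Longrightarrow> openin X V"
    "\<And>U. openin X U \<Longrightarrow> x \<in> U \<Longrightarrow> \<exists>V\<in>\<B>. x \<in> V \<and> V \<subseteq> U"
    using assms xX unfolding first_countable_def by meson
  define \<C> where "\<C> = {V \<in> \<B>. x \<in> V}"
  have \<C>: "countable \<C>" "\<C> \<noteq> {}"
    using \<B>(1) \<B>(3)[OF openin_topspace xX] by (auto simp: \<C>_def)
  \<comment> \<open>Finite intersections turn the countable base into a decreasing one, so that any choice of
    points \<open>s n \<in> D n\<close> converges.\<close>
  define D where "D n = (\<Inter>k\<le>n. from_nat_into \<C> k)" for n :: nat
  have mem: "from_nat_into \<C> k \<in> \<C>" for k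
    by (simp add: \<C>(2) from_nat_into)
  have D: "openin X (D n)" "x \<in> D n" for n
  proof -
    show "openin X (D n)"
      unfolding D_def using mem \<B>(2) by (intro openin_INT2) (auto simp: \<C>_def)
    show "x \<in> D n"
      using mem by (auto simp: D_def \<C>_def)
  qed
  have "\<exists>a. a \<in> A \<and> a \<in> D n" for n
    using x D[of n] unfolding in_closure_of by blast
  then obtain s where s: "\<And>n. s n \<in> A" "\<And>n. s n \<in> D n"
    by metis
  have "limitin X s x sequentially"
    unfolding limitin_sequentially
  proof (intro conjI allI impI xX, elim conjE)
    fix U assume "openin X U" "x \<in> U"
    then obtain V where V: "V \<in> \<C>" "V \<subseteq> U"
      using \<B>(3) unfolding \<C>_def by blast
    then obtain k where "from_nat_into \<C> k = V"
      using \<C>(1) from_nat_into_surj by metis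
    then have "D n \<subseteq> U" if "k \<le> n" for n
      using V(2) that by (auto simp: D_def)
    then show "\<exists>N. \<forall>n\<ge>N. s n \<in> U"
      using s(2) by blast
  qed
  then show "\<exists>s. range s \<subseteq> A \<and> limitin X s x sequentially"
    using s(1) by blast
qed

lemma Frechet_space_imp_countable_tightness:
  assumes "Frechet_space X"
  shows "countable_tightness X"
  unfolding countable_tightness_def
proof (intro allI impI, elim conjE)
  fix A x
  assume "A \<subseteq> topspace X" "x \<in> X closure_of A"
  then obtain s :: "nat \<Rightarrow> 'a" where s: "range s \<subseteq> A" "limitin X s x sequentially"
    using assms unfolding Frechet_space_def by blast
  have "x \<in> X closure_of range s"
    using s(2) unfolding in_closure_of limitin_sequentially by blast
  then show "\<exists>M\<subseteq>A. countable M \<and> x \<in> X closure_of M"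
    using s(1) by blast
qed

section \<open>Functions on compact Hausdorff spaces\<close>

lemma point_open_separating_function:
  assumes "compact_space X" "Hausdorff_space X" "openin X U" "p \<in> U"
  shows "\<exists>g. continuous_map X euclideanreal g \<and> g p = (0::real) \<and> (\<forall>x\<in>topspace X - U. g x = 1)"
proof -
  have "p \<in> topspace X"
    using openin_subset assms(3,4) by blast
  then have "closedin X {p}"
    using assms(2) by (simp add: closedin_Hausdorff_singleton)
  moreover have "normal_space X"
    using assms(1,2) by (simp add: compact_Hausdorff_or_regular_imp_normal_space)
  moreover have "closedin X (topspace X - U)"
    using assms(3) by blast
  moreover have "disjnt {p} (topspace X - U)"
    using assms(4) by (simp add: disjnt_def)
  ultimately obtain g where "continuous_map X (top_of_set {0..1::real}) g"
      "g ` {p} \<subseteq> {0}" "g ` (topspace X - U) \<subseteq> {1}"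
    using Urysohn_lemma[of X "{p}" "topspace X - U" 0 1] by auto
  then show ?thesis
    by (intro exI[of _ g]) (auto simp: continuous_map_in_subtopology)
qed

text \<open>The finite intersection property for an indexed family. The witnesses are required to lie
  in the space, which matters for the empty subfamily: its intersection is the whole type.\<close>

lemma compact_space_closed_family:
  assumes "compact_space X" "\<And>i. i \<in> I \<Longrightarrow> closedin X (C i)"
    and fin: "\<And>J. finite J \<Longrightarrow> J \<subseteq> I \<Longrightarrow> \<exists>x\<in>topspace X. \<forall>j\<in>J. x \<in> C j"
  shows "\<exists>x\<in>topspace X. \<forall>i\<in>I. x \<in> C i"
proof -
  have "\<Inter>\<F> \<noteq> {}" if \<F>: "finite \<F>" "\<F> \<subseteq> insert (topspace X) (C ` I)" for \<F>
  proof -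
    have "finite (\<F> - {topspace X})" "\<F> - {topspace X} \<subseteq> C ` I"
      using \<F> by auto
    then obtain J where J: "finite J" "J \<subseteq> I" "\<F> - {topspace X} = C ` J"
      using finite_subset_image by metis
    with fin[of J] obtain x where "x \<in> topspace X" "\<forall>j\<in>J. x \<in> C j"
      by blast
    then have "x \<in> \<Inter>\<F>"
      using J(3) by blast
    then show ?thesis
      by blast
  qed
  moreover have "\<forall>D\<in>insert (topspace X) (C ` I). closedin X D"
    using assms(2) by blast
  ultimately have "\<Inter>(insert (topspace X) (C ` I)) \<noteq> {}"
    using assms(1)[unfolded compact_space_fip, THEN spec, of "insert (topspace X) (C ` I)"]
    by simp
  then show ?thesis
    by blast
qed

text \<open>The functions together map \<open>X\<close> injectively into a countable power of the real line, and a
  continuous injection of a compact space into a Hausdorff space is an embedding.\<close>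

lemma metrizable_space_of_countable_separating_family:
  fixes q :: "'i::countable \<Rightarrow> 'a \<Rightarrow> real"
  assumes "compact_space X" "\<And>i. continuous_map X euclideanreal (q i)"
    and sep: "\<And>x y. x \<in> topspace X \<Longrightarrow> y \<in> topspace X \<Longrightarrow> (\<And>i. q i x = q i y) \<Longrightarrow> x = y"
  shows "metrizable_space X"
proof -
  let ?Y = "powertop_real (UNIV :: 'i set)"
  have metr: "metrizable_space ?Y"
    by (simp add: metrizable_space_product_topology metrizable_space_euclidean)
  have "continuous_map X ?Y (\<lambda>x i. q i x)"
    using assms(2) by (simp add: continuous_map_componentwise_UNIV)
  moreover have "inj_on (\<lambda>x i. q i x) (topspace X)"
    using sep by (intro inj_onI) metis
  ultimately have "embedding_map X ?Y (\<lambda>x i. q i x)"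
    using assms(1) metr by (simp add: continuous_imp_embedding_map metrizable_imp_Hausdorff_space)
  from homeomorphic_metrizable_space[OF embedding_map_imp_homeomorphic_space[OF this]]
  show ?thesis
    by (simp add: metrizable_space_subtopology[OF metr])
qed

section \<open>Countable tightness and countable \<open>\<pi>\<close>-character\<close>

text \<open>The cardinal \<open>\<omega>\<^sub>1\<close>, in the form in which it indexes the recursion: a strict well-order in
  which every proper initial segment is countable although the whole field is not.\<close>

lemma uncountable_well_order_with_countable_segments:
  obtains R :: "nat set rel" and I :: "nat set set"
  where "wf R" "trans R" "uncountable I"
    "\<And>i j. i \<in> I \<Longrightarrow> j \<in> I \<Longrightarrow> i \<noteq> j \<Longrightarrow> (i, j) \<in> R \<or> (j, i) \<in> R"
    "\<And>i. countable {j. (j, i) \<in> R}"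
    "R \<subseteq> I \<times> I"
proof -
  include cardinal_syntax
  define r where "r = cardSuc natLeq"
  have card: "Card_order r"
    by (simp add: r_def cardSuc_Card_order natLeq_Card_order)
  then have wo: "Well_order r"
    by (simp add: card_order_on_well_order_on)
  then have "wf (r - Id)" "Linear_order r"
    by (auto simp: well_order_on_def)
  then have lin: "trans r" "antisym r" "total_on (Field r) r"
    by (auto simp: linear_order_on_def partial_order_on_def preorder_on_def)
  have countable_iff: "countable A \<longleftrightarrow> |A| \<le>o natLeq" for A :: "nat set set"
  proof -
    have "countable A \<longleftrightarrow> |A| \<le>o |UNIV :: nat set|"
      by (auto simp: countable_def card_of_ordLeq[symmetric])
    then show ?thesis
      using card_of_nat ordIso_symmetric ordLeq_ordIso_trans by blast
  qed
  have "natLeq <o r"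
    by (simp add: r_def cardSuc_greater natLeq_Card_order)
  have unc: "uncountable (Field r)"
  proof
    assume "countable (Field r)"
    then have "|Field r| \<le>o natLeq"
      by (simp add: countable_iff)
    then have "r \<le>o natLeq"
      using card card_of_Field_ordIso ordIso_ordLeq_trans ordIso_symmetric by blast
    then show False
      using \<open>natLeq <o r\<close> not_ordLess_ordLeq by blast
  qed
  have seg: "countable {j. (j, i) \<in> r - Id}" for i
  proof (cases "i \<in> Field r")
    case True
    then have "|underS r i| <o r"
      using card by (simp add: card_of_underS)
    then have "|underS r i| \<le>o natLeq"
      using cardSuc_ordLeq_ordLess[OF natLeq_Card_order card_of_Card_order, of "underS r i"]
      by (simp add: r_def)
    then have "countable (underS r i)"
      by (simp add: countable_iff)
    moreover have "{j. (j, i) \<in> r - Id} = underS r i"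
      by (auto simp: underS_def)
    ultimately show ?thesis
      by simp
  next
    case False
    then have "{j. (j, i) \<in> r - Id} = {}"
      by (auto simp: Field_def)
    then show ?thesis
      by (simp only: countable_empty)
  qed
  show thesis
  proof (rule that[where R = "r - Id" and I = "Field r"])
    show "trans (r - Id)"
      using lin by (simp add: trans_diff_Id)
    show "(i, j) \<in> r - Id \<or> (j, i) \<in> r - Id" if "i \<in> Field r" "j \<in> Field r" "i \<noteq> j" for i j
      using lin(3) that by (auto simp: total_on_def)
    show "r - Id \<subseteq> Field r \<times> Field r"
      by (auto simp: Field_def)
  qed (use unc seg \<open>wf (r - Id)\<close> in auto)
qed

text \<open>A closed set that is the zero set of a continuous \<open>h\<close> has a countable base of neighbourhoods
  in a compact space, namely the sets \<open>{\<bar>h\<bar> < 1/n}\<close>. If every neighbourhood of \<open>p\<close> contained one of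
  countably many given zero sets, it would also contain one of these neighbourhoods, and \<open>p\<close> would
  have a countable \<open>\<pi>\<close>-base.\<close>

lemma function_escaping_zero_sets:
  assumes X: "compact_space X" "Hausdorff_space X" and p: "p \<in> topspace X"
    and no: "\<nexists>\<P>. countable \<P> \<and> pi_base_at X p \<P>"
    and H: "countable H" "\<And>h. h \<in> H \<Longrightarrow> continuous_map X euclideanreal h"
  shows "\<exists>g. continuous_map X euclideanreal g \<and> g p = 0 \<and>
    (\<forall>h\<in>H. (\<exists>x\<in>topspace X. h x = 0) \<longrightarrow> (\<exists>x\<in>topspace X. h x = 0 \<and> g x = 1))"
proof -
  define nbhd where "nbhd h m = {x \<in> topspace X. \<bar>h x\<bar> < 1 / real (Suc m)}" for h :: "'a \<Rightarrow> real" and m :: nat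
  define \<P> where "\<P> = (\<lambda>(h, m). nbhd h m) ` ({h \<in> H. \<exists>x\<in>topspace X. h x = 0} \<times> UNIV)"
  have "countable \<P>"
    unfolding \<P>_def using H(1) by simp
  have op: "openin X (nbhd h m)" if "h \<in> H" for h m
  proof -
    have "continuous_map X euclideanreal (\<lambda>x. \<bar>h x\<bar>)"
      using H(2)[OF that] by (rule continuous_map_real_abs)
    then have "openin X {x \<in> topspace X. \<bar>h x\<bar> \<in> {..<1 / real (Suc m)}}"
      by (rule openin_continuous_map_preimage) (simp add: open_lessThan)
    then show ?thesis
      by (simp add: nbhd_def)
  qed
  have ope: "\<forall>V\<in>\<P>. openin X V \<and> V \<noteq> {}"
  proof
    fix V assume "V \<in> \<P>"
    then obtain h m x where "h \<in> H" "V = nbhd h m" "x \<in> topspace X" "h x = 0"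
      by (auto simp: \<P>_def)
    then have "openin X V" "x \<in> V"
      using op by (auto simp: nbhd_def)
    then show "openin X V \<and> V \<noteq> {}"
      by blast
  qed
  have "\<not> pi_base_at X p \<P>"
    using no \<open>countable \<P>\<close> by blast
  with ope obtain U where U: "openin X U" "p \<in> U" "\<And>V. V \<in> \<P> \<Longrightarrow> \<not> V \<subseteq> U"
    unfolding pi_base_at_def by meson
  have esc: "\<exists>x\<in>topspace X - U. h x = 0" if h: "h \<in> H" "\<exists>x\<in>topspace X. h x = 0" for h
  proof (rule ccontr)
    assume *: "\<not> ?thesis"
    have notsub: "\<not> nbhd h m \<subseteq> U" for m
      using U(3)[of "nbhd h m"] h by (auto simp: \<P>_def)
    have "compactin X (topspace X - U)"
      using X(1) U(1) by (simp add: closedin_compact_space closedin_diff)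
    moreover have "continuous_map X euclideanreal (\<lambda>x. \<bar>h x\<bar>)"
      using H(2)[OF h(1)] by (rule continuous_map_real_abs)
    ultimately have "compact ((\<lambda>x. \<bar>h x\<bar>) ` (topspace X - U))"
      using image_compactin by fastforce
    moreover have "(\<lambda>x. \<bar>h x\<bar>) ` (topspace X - U) \<noteq> {}"
      using notsub[of 0] by (auto simp: nbhd_def)
    ultimately obtain s where "s \<in> (\<lambda>x. \<bar>h x\<bar>) ` (topspace X - U)"
        "\<forall>t\<in>(\<lambda>x. \<bar>h x\<bar>) ` (topspace X - U). s \<le> t"
      by (metis compact_attains_inf)
    then obtain x where x: "x \<in> topspace X - U" "\<And>y. y \<in> topspace X - U \<Longrightarrow> \<bar>h x\<bar> \<le> \<bar>h y\<bar>"
      by blast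
    then have "0 < \<bar>h x\<bar>"
      using * by auto
    then obtain m where "1 / real (Suc m) < \<bar>h x\<bar>"
      using nat_approx_posE by metis
    then have "nbhd h m \<subseteq> U"
      using x(2) by (force simp: nbhd_def)
    then show False
      using notsub by blast
  qed
  obtain g where g: "continuous_map X euclideanreal g" "g p = 0" "\<forall>x\<in>topspace X - U. g x = 1"
    using point_open_separating_function[OF X U(1,2)] by blast
  show ?thesis
  proof (intro exI[of _ g] conjI ballI impI g(1,2))
    fix h assume "h \<in> H" "\<exists>x\<in>topspace X. h x = 0"
    from esc[OF this] g(3) show "\<exists>x\<in>topspace X. h x = 0 \<and> g x = 1"
      by auto
  qed
qed

text \<open>The condition imposed on each function of the recursion with respect to the set \<open>S\<close> of its
  predecessors. A finite pattern prescribes the value \<open>0\<close> for some predecessors and \<open>1\<close> for others;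
  a pattern that is realized at all must be realized at a point where the new function is \<open>1\<close>.\<close>

definition extends_patterns :: "'a topology \<Rightarrow> 'a \<Rightarrow> ('a \<Rightarrow> real) set \<Rightarrow> ('a \<Rightarrow> real) \<Rightarrow> bool" where
  "extends_patterns X p S g \<longleftrightarrow>
    continuous_map X euclideanreal g \<and> g p = 0 \<and>
    (\<forall>A B. finite A \<and> A \<subseteq> S \<and> finite B \<and> B \<subseteq> S \<and>
        (\<exists>x\<in>topspace X. (\<forall>a\<in>A. a x = 0) \<and> (\<forall>b\<in>B. b x = 1)) \<longrightarrow>
        (\<exists>x\<in>topspace X. (\<forall>a\<in>A. a x = 0) \<and> (\<forall>b\<in>B. b x = 1) \<and> g x = 1))"

lemma extends_patterns_exists:
  assumes "compact_space X" "Hausdorff_space X" "p \<in> topspace X"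
    and "\<nexists>\<P>. countable \<P> \<and> pi_base_at X p \<P>"
    and S: "countable S" "\<And>f. f \<in> S \<Longrightarrow> continuous_map X euclideanreal f"
  shows "\<exists>g. extends_patterns X p S g"
proof -
  \<comment> \<open>The set on which a pattern is realized is the zero set of a single continuous function.\<close>
  define h where "h A B x = (\<Sum>a\<in>A. \<bar>a x\<bar>) + (\<Sum>b\<in>B. \<bar>b x - 1\<bar>)"
    for A B :: "('a \<Rightarrow> real) set" and x
  define F where "F = {A. finite A \<and> A \<subseteq> S}"
  have "countable F"
    using countable_Collect_finite_subset[OF S(1)] by (simp add: F_def)
  then have "countable ((\<lambda>(A, B). h A B) ` (F \<times> F))"
    by simp
  moreover have "continuous_map X euclideanreal f" if "f \<in> (\<lambda>(A, B). h A B) ` (F \<times> F)" for f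
  proof -
    from that obtain A B where AB: "f = h A B" "A \<in> F" "B \<in> F"
      by auto
    have "continuous_map X euclideanreal (\<lambda>x. (\<Sum>a\<in>A. \<bar>a x\<bar>) + (\<Sum>b\<in>B. \<bar>b x - 1\<bar>))"
      using AB S(2)
      by (intro continuous_map_add continuous_map_sum continuous_map_real_abs continuous_map_diff)
         (auto simp: F_def)
    then show ?thesis
      by (simp add: AB(1) h_def[abs_def])
  qed
  ultimately have "\<exists>g. continuous_map X euclideanreal g \<and> g p = 0 \<and>
      (\<forall>f\<in>(\<lambda>(A, B). h A B) ` (F \<times> F). (\<exists>x\<in>topspace X. f x = 0) \<longrightarrow>
        (\<exists>x\<in>topspace X. f x = 0 \<and> g x = 1))"
    by (rule function_escaping_zero_sets[OF assms(1-4)])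
  then obtain g where g: "continuous_map X euclideanreal g" "g p = 0"
    and esc: "\<forall>f\<in>(\<lambda>(A, B). h A B) ` (F \<times> F). (\<exists>x\<in>topspace X. f x = 0) \<longrightarrow>
       (\<exists>x\<in>topspace X. f x = 0 \<and> g x = 1)"
    by (elim exE conjE)
  have h0: "h A B x = 0 \<longleftrightarrow> (\<forall>a\<in>A. a x = 0) \<and> (\<forall>b\<in>B. b x = 1)"
    if "A \<in> F" "B \<in> F" for A B x
    using that by (simp add: h_def F_def add_nonneg_eq_0_iff sum_nonneg sum_nonneg_eq_0_iff)
  have "extends_patterns X p S g"
    unfolding extends_patterns_def
  proof (intro conjI allI impI g, elim conjE)
    fix A B
    assume "finite A" "A \<subseteq> S" "finite B" "B \<subseteq> S"
      and ex: "\<exists>x\<in>topspace X. (\<forall>a\<in>A. a x = 0) \<and> (\<forall>b\<in>B. b x = 1)"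
    then have "A \<in> F" "B \<in> F"
      by (auto simp: F_def)
    moreover from this have "h A B \<in> (\<lambda>(A, B). h A B) ` (F \<times> F)"
      by (intro image_eqI[of _ _ "(A, B)"]) auto
    ultimately show "\<exists>x\<in>topspace X. (\<forall>a\<in>A. a x = 0) \<and> (\<forall>b\<in>B. b x = 1) \<and> g x = 1"
      using bspec[OF esc, of "h A B"] ex by (simp add: h0 conj_assoc)
  qed
  then show ?thesis
    by blast
qed

text \<open>At a point without a countable \<open>\<pi>\<close>-base, compactness and the pattern condition produce a
  free sequence of length \<open>\<omega>\<^sub>1\<close>, which countable tightness forbids.\<close>

theorem countable_tightness_imp_countable_pi_character:
  assumes X: "compact_space X" "Hausdorff_space X" and tight: "countable_tightness X"
  shows "countable_pi_character X"
  unfolding countable_pi_character_def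
proof (rule ballI, rule ccontr)
  fix p assume p: "p \<in> topspace X" and no: "\<nexists>\<P>. countable \<P> \<and> pi_base_at X p \<P>"
  obtain R and I :: "nat set set" where R: "wf R" "trans R" "uncountable I"
    "\<And>i j. i \<in> I \<Longrightarrow> j \<in> I \<Longrightarrow> i \<noteq> j \<Longrightarrow> (i, j) \<in> R \<or> (j, i) \<in> R"
    "\<And>i. countable {j. (j, i) \<in> R}" "R \<subseteq> I \<times> I"
    by (rule uncountable_well_order_with_countable_segments) (rule that)
  have "\<exists>f. \<forall>i. extends_patterns X p (f ` {j. (j, i) \<in> R}) (f i)"
  proof (rule dependent_wf_choice[OF R(1)])
    fix f g :: "nat set \<Rightarrow> 'a \<Rightarrow> real" and i r
    assume "\<And>j. (j, i) \<in> R \<Longrightarrow> f j = g j"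
    then have "f ` {j. (j, i) \<in> R} = g ` {j. (j, i) \<in> R}"
      by (auto simp: image_iff)
    then show "extends_patterns X p (f ` {j. (j, i) \<in> R}) r = extends_patterns X p (g ` {j. (j, i) \<in> R}) r"
      by simp
  next
    fix i and f :: "nat set \<Rightarrow> 'a \<Rightarrow> real"
    assume "\<And>j. (j, i) \<in> R \<Longrightarrow> extends_patterns X p (f ` {k. (k, j) \<in> R}) (f j)"
    then have "continuous_map X euclideanreal (f j)" if "(j, i) \<in> R" for j
      using that by (simp add: extends_patterns_def)
    then show "\<exists>r. extends_patterns X p (f ` {j. (j, i) \<in> R}) r"
      using R(5)[of i] by (intro extends_patterns_exists X p no) auto
  qed
  then obtain f where f: "\<And>i. extends_patterns X p (f ` {j. (j, i) \<in> R}) (f i)"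
    by blast
  then have cont: "continuous_map X euclideanreal (f i)" and fp: "f i p = 0" for i
    by (simp_all add: extends_patterns_def)
  have irrefl: "(i, i) \<notin> R" for i
    using R(1) by simp
  have last: "\<exists>m\<in>J. \<forall>j\<in>J. j = m \<or> (j, m) \<in> R" if J: "finite J" "J \<noteq> {}" "J \<subseteq> I" for J
    using J
  proof (induction J rule: finite_ne_induct)
    case (insert j J)
    then obtain m where m: "m \<in> J" "\<forall>j\<in>J. j = m \<or> (j, m) \<in> R"
      by auto
    consider "j = m \<or> (j, m) \<in> R" | "(m, j) \<in> R"
      using R(4)[of j m] insert.prems m(1) by blast
    then show ?case
    proof cases
      case 1
      then show ?thesis
        using m by (intro bexI[of _ m]) auto
    next
      case 2
      then have "\<forall>k\<in>J. (k, j) \<in> R"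
        using m(2) R(2) by (metis transD)
      then show ?thesis
        by (intro bexI[of _ j]) auto
    qed
  qed simp
  have fclosed: "closedin X {x \<in> topspace X. f i x = c}" for i c
    using closedin_continuous_map_preimage[OF cont, of "{c}" i] by simp
  \<comment> \<open>The point \<open>p\<close> realizes the zeros. The ones are added in increasing order of their indices, so
    that each new function has all others of the pattern among its predecessors; the induction
    therefore removes the largest index.\<close>
  have finite_pattern: "\<exists>x\<in>topspace X. (\<forall>k\<in>K. f k x = 0) \<and> (\<forall>j\<in>J. f j x = 1)"
    if K: "finite K" "K \<subseteq> insert i {k. (k, i) \<in> R}" and J: "finite J" "J \<subseteq> {j. (i, j) \<in> R}" for i J K
    using J
  proof (induction "card J" arbitrary: J)
    case 0
    then show ?case
      using p fp by (intro bexI[of _ p]) auto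
  next
    case (Suc n)
    then have "J \<noteq> {}" "J \<subseteq> I"
      using R(6) by auto
    then obtain m where m: "m \<in> J" "\<forall>j\<in>J. j = m \<or> (j, m) \<in> R"
      using last Suc.prems(1) by blast
    have im: "(i, m) \<in> R"
      using m(1) Suc.prems(2) by blast
    have "n = card (J - {m})"
      using Suc.hyps(2) m(1) Suc.prems(1) by simp
    then have "\<exists>x\<in>topspace X. (\<forall>k\<in>K. f k x = 0) \<and> (\<forall>j\<in>J - {m}. f j x = 1)"
      by (rule Suc.hyps(1)) (use Suc.prems in auto)
    then have "\<exists>x\<in>topspace X. (\<forall>a\<in>f ` K. a x = 0) \<and> (\<forall>b\<in>f ` (J - {m}). b x = 1)"
      by simp
    moreover have "f ` K \<subseteq> f ` {j. (j, m) \<in> R}"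
      using K(2) im transD[OF R(2)] by (intro image_mono) blast
    moreover have "f ` (J - {m}) \<subseteq> f ` {j. (j, m) \<in> R}"
      using m(2) by (intro image_mono) blast
    ultimately have "\<exists>x\<in>topspace X. (\<forall>a\<in>f ` K. a x = 0) \<and> (\<forall>b\<in>f ` (J - {m}). b x = 1) \<and> f m x = 1"
      using f[of m, unfolded extends_patterns_def, THEN conjunct2, THEN conjunct2,
          THEN spec[of _ "f ` K"], THEN spec[of _ "f ` (J - {m})"]] K(1) Suc.prems(1)
      by simp
    then show ?case
      by force
  qed
  have "\<exists>x\<in>topspace X. (\<forall>j. j = i \<or> (j, i) \<in> R \<longrightarrow> f j x = 0) \<and> (\<forall>j. (i, j) \<in> R \<longrightarrow> f j x = 1)" for i
  proof -
    define D where "D = insert i {j. (j, i) \<in> R}"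
    define E where "E = {j. (i, j) \<in> R}"
    have DE: "j \<notin> E" if "j \<in> D" for j
      using that irrefl transD[OF R(2)] by (auto simp: D_def E_def)
    have "\<exists>x\<in>topspace X. \<forall>j\<in>D \<union> E. x \<in> {x \<in> topspace X. f j x = (if j \<in> D then 0 else 1)}"
    proof (rule compact_space_closed_family[OF X(1) fclosed])
      fix J assume J: "finite J" "J \<subseteq> D \<union> E"
      then have "\<exists>x\<in>topspace X. (\<forall>k\<in>J \<inter> D. f k x = 0) \<and> (\<forall>j\<in>J - D. f j x = 1)"
        by (intro finite_pattern[of _ i]) (auto simp: D_def E_def)
      then show "\<exists>x\<in>topspace X. \<forall>j\<in>J. x \<in> {x \<in> topspace X. f j x = (if j \<in> D then 0 else 1)}"
        by fastforce
    qed
    then obtain x where "x \<in> topspace X" "\<And>j. j \<in> D \<union> E \<Longrightarrow> f j x = (if j \<in> D then 0 else 1)"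
      by auto
    with DE show ?thesis
      by (intro bexI[of _ x]) (auto simp: D_def E_def)
  qed
  then obtain x where x: "\<And>i. x i \<in> topspace X" "\<And>i j. j = i \<or> (j, i) \<in> R \<Longrightarrow> f j (x i) = 0"
    "\<And>i j. (i, j) \<in> R \<Longrightarrow> f j (x i) = 1"
    by metis
  have "I \<noteq> {}"
    using R(3) by auto
  \<comment> \<open>For finitely many indices with maximum \<open>m\<close>, the point \<open>x m\<close> is a common zero.\<close>
  have "\<exists>y\<in>topspace X. \<forall>i\<in>I. y \<in> X closure_of (x ` I) \<inter> {y \<in> topspace X. f i y = 0}"
  proof (rule compact_space_closed_family[OF X(1)])
    fix J assume J: "finite J" "J \<subseteq> I"
    show "\<exists>y\<in>topspace X. \<forall>i\<in>J. y \<in> X closure_of (x ` I) \<inter> {y \<in> topspace X. f i y = 0}"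
    proof (cases "J = {}")
      case True
      then show ?thesis
        using p by auto
    next
      case False
      then obtain m where m: "m \<in> J" "\<forall>j\<in>J. j = m \<or> (j, m) \<in> R"
        using last[OF J(1) False J(2)] by blast
      have "x ` I \<subseteq> topspace X" "x m \<in> x ` I"
        using x(1) m(1) J(2) by auto
      then have "x m \<in> X closure_of (x ` I)"
        using closure_of_subset[of "x ` I" X] by blast
      moreover have "f j (x m) = 0" if "j \<in> J" for j
        using m(2) x(2) that by blast
      ultimately show ?thesis
        using x(1) by (intro bexI[of _ "x m"]) auto
    qed
  qed (use fclosed in auto)
  then obtain y where y: "y \<in> X closure_of (x ` I)" "\<And>i. i \<in> I \<Longrightarrow> f i y = 0"
    using \<open>I \<noteq> {}\<close> by blast
  have "x ` I \<subseteq> topspace X"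
    using x(1) by auto
  then obtain M where M: "M \<subseteq> x ` I" "countable M" "y \<in> X closure_of M"
    using tight[unfolded countable_tightness_def, THEN spec, THEN spec, of "x ` I" y] y(1) by auto
  then obtain J where J: "countable J" "J \<subseteq> I" "M = x ` J"
    using countable_subset_image[of M x I] by auto
  \<comment> \<open>A countable set of indices has a strict upper bound: the indices that are not such a bound
    form a countable union of countable initial segments.\<close>
  have "countable (J \<union> (\<Union>j\<in>J. {k. (k, j) \<in> R}))"
    using J(1) R(5) by auto
  then obtain i where i: "i \<in> I" "i \<notin> J \<union> (\<Union>j\<in>J. {k. (k, j) \<in> R})"
    using R(3) countable_subset[of I] by (meson subsetI)
  then have "(j, i) \<in> R" if "j \<in> J" for j
    using that R(4)[of i j] J(2) by blast
  then have "f i z = 1" if "z \<in> M" for z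
    using that x(3) J(3) by blast
  then have "f i y = 1"
    using forall_in_closure_of[OF M(3), of "\<lambda>z. f i z = 1"] fclosed by blast
  then show False
    using y(2)[OF i(1)] by simp
qed

section \<open>Countable \<open>\<pi>\<close>-character and metrizability\<close>

context CHART_group
begin

lemma continuous_left_shift: "l \<in> topological_center G X \<Longrightarrow> continuous_map X X (\<lambda>h. l \<otimes> h)"
  by (simp add: topological_center_def)

lemma center_carrier: "l \<in> topological_center G X \<Longrightarrow> l \<in> carrier G"
  by (simp add: topological_center_def)

lemma openin_right_translate:
  assumes "openin X U" "h \<in> carrier G"
  shows "openin X {g \<in> carrier G. g \<otimes> h \<in> U}"
  using openin_continuous_map_preimage[OF continuous_right_shift[OF assms(2)] assms(1)]
  by (simp add: topspace_eq_carrier)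

lemma open_meets_center:
  assumes "openin X U" "U \<noteq> {}"
  shows "\<exists>l\<in>topological_center G X. l \<in> U"
proof -
  obtain u where "u \<in> U"
    using assms(2) by blast
  then have "u \<in> X closure_of topological_center G X"
    using topological_center_dense openin_subset[OF assms(1)] by blast
  with \<open>u \<in> U\<close> assms(1) show ?thesis
    unfolding in_closure_of by blast
qed

text \<open>For each \<open>g\<close> the set of all \<open>k\<close> with \<open>k \<otimes> g \<in> P\<close> is open, as right shifts are continuous,
  and nonempty, so it meets the dense center. Thus the preimages of \<open>P\<close> under left shifts by center
  elements form an open cover, and compactness leaves finitely many of them.\<close>

lemma finitely_many_center_shifts_cover:
  assumes P: "openin X P" "P \<noteq> {}"
  shows "\<exists>L\<subseteq>topological_center G X. finite L \<and> (\<forall>g\<in>carrier G. \<exists>l\<in>L. l \<otimes> g \<in> P)"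
proof -
  define W where "W l = {g \<in> carrier G. l \<otimes> g \<in> P}" for l
  have "openin X (W l)" if "l \<in> topological_center G X" for l
    using openin_continuous_map_preimage[OF continuous_left_shift[OF that] P(1)]
    by (simp add: W_def topspace_eq_carrier)
  moreover have "\<exists>l\<in>topological_center G X. g \<in> W l" if g: "g \<in> carrier G" for g
  proof -
    obtain u where u: "u \<in> P" "u \<in> carrier G"
      using P openin_subset topspace_eq_carrier by blast
    have "u \<otimes> inv g \<in> {k \<in> carrier G. k \<otimes> g \<in> P}"
      using u g by (simp add: m_assoc)
    then obtain l where "l \<in> topological_center G X" "l \<in> {k \<in> carrier G. k \<otimes> g \<in> P}"
      using open_meets_center[OF openin_right_translate[OF P(1) g]] by blast
    then show ?thesis
      using g by (auto simp: W_def)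
  qed
  ultimately have "(\<forall>U\<in>W ` topological_center G X. openin X U) \<and>
      topspace X \<subseteq> \<Union>(W ` topological_center G X)"
    by (auto simp: topspace_eq_carrier)
  then obtain \<F> where \<F>: "finite \<F>" "\<F> \<subseteq> W ` topological_center G X" "topspace X \<subseteq> \<Union>\<F>"
    using compact unfolding compact_space_alt by meson
  then obtain L where "L \<subseteq> topological_center G X" "finite L" "\<F> = W ` L"
    using finite_subset_image by metis
  with \<F>(3) show ?thesis
    by (intro exI[of _ L]) (auto simp: W_def topspace_eq_carrier)
qed

text \<open>The finite sets of the preceding lemma, one for each member of the \<open>\<pi>\<close>-base, have a dense
  union: a neighbourhood of \<open>g\<close> contains some \<open>P g\<close>, and the \<open>l\<close> that moves \<open>inv g\<close> into \<open>P\<close>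
  lies in \<open>P g\<close>.\<close>

lemma countable_dense_subset_of_center:
  assumes "countable \<P>" "pi_base_at X \<one> \<P>"
  shows "\<exists>H\<subseteq>topological_center G X. countable H \<and> X closure_of H = topspace X"
proof -
  have "\<forall>P\<in>\<P>. \<exists>L\<subseteq>topological_center G X. finite L \<and> (\<forall>g\<in>carrier G. \<exists>l\<in>L. l \<otimes> g \<in> P)"
    using assms(2) finitely_many_center_shifts_cover unfolding pi_base_at_def by simp
  then obtain L where L: "\<And>P. P \<in> \<P> \<Longrightarrow> L P \<subseteq> topological_center G X"
      "\<And>P. P \<in> \<P> \<Longrightarrow> finite (L P)" "\<And>P g. P \<in> \<P> \<Longrightarrow> g \<in> carrier G \<Longrightarrow> \<exists>l\<in>L P. l \<otimes> g \<in> P"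
    by metis
  define H where "H = (\<Union>P\<in>\<P>. L P)"
  have "countable H"
    unfolding H_def using assms(1) L(2) by (intro countable_UN) (auto intro: countable_finite)
  moreover have sub: "H \<subseteq> topological_center G X"
    using L(1) by (auto simp: H_def)
  moreover have "g \<in> X closure_of H" if g: "g \<in> carrier G" for g
    unfolding in_closure_of
  proof (intro conjI allI impI g[folded topspace_eq_carrier], elim conjE)
    fix U assume "g \<in> U" "openin X U"
    then have "openin X {k \<in> carrier G. k \<otimes> g \<in> U}" "\<one> \<in> {k \<in> carrier G. k \<otimes> g \<in> U}"
      using g openin_right_translate by auto
    then obtain P where P: "P \<in> \<P>" "P \<subseteq> {k \<in> carrier G. k \<otimes> g \<in> U}"
      using assms(2) unfolding pi_base_at_def by blast
    then obtain l where l: "l \<in> L P" "l \<otimes> inv g \<in> P"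
      using L(3) g by blast
    then have "l \<in> carrier G"
      using L(1) P(1) center_carrier by blast
    then have "l \<otimes> inv g \<otimes> g = l"
      using g by (simp add: m_assoc)
    then have "l \<in> U"
      using l(2) P(2) by auto
    then show "\<exists>y. y \<in> H \<and> y \<in> U"
      using l(1) P(1) by (auto simp: H_def)
  qed
  ultimately show ?thesis
    using closure_of_subset_topspace[of X H] topspace_eq_carrier by blast
qed

text \<open>If \<open>z\<close> is not the identity, then by the Hausdorff property and continuity of the right shift
  by \<open>z\<close> some neighbourhood \<open>W\<close> of the identity is disjoint from \<open>W z\<close>. A member \<open>P\<close> of the
  \<open>\<pi>\<close>-base inside \<open>W\<close> carries a function that is nonzero somewhere on \<open>P\<close> but zero on \<open>P z\<close>.\<close>

lemma eq_one_of_invariance: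
  assumes base: "pi_base_at X \<one> \<P>"
    and f: "\<And>P. P \<in> \<P> \<Longrightarrow> \<exists>w\<in>P. f P w \<noteq> (0::real)"
      "\<And>P g. P \<in> \<P> \<Longrightarrow> g \<in> carrier G - P \<Longrightarrow> f P g = 0"
    and z: "z \<in> carrier G" "\<And>P g. P \<in> \<P> \<Longrightarrow> g \<in> carrier G \<Longrightarrow> f P (g \<otimes> z) = f P g"
  shows "z = \<one>"
proof (rule ccontr)
  assume "z \<noteq> \<one>"
  then obtain U V where UV: "openin X U" "openin X V" "\<one> \<in> U" "z \<in> V" "disjnt U V"
    using Hausdorff z(1) unfolding Hausdorff_space_def topspace_eq_carrier by (metis one_closed)
  have "openin X (U \<inter> {k \<in> carrier G. k \<otimes> z \<in> V})" "\<one> \<in> U \<inter> {k \<in> carrier G. k \<otimes> z \<in> V}"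
    using UV z(1) openin_right_translate by auto
  then obtain P where P: "P \<in> \<P>" "P \<subseteq> U \<inter> {k \<in> carrier G. k \<otimes> z \<in> V}"
    using base unfolding pi_base_at_def by meson
  then obtain w where w: "w \<in> P" "f P w \<noteq> 0"
    using f(1) by blast
  then have wc: "w \<in> carrier G" "w \<otimes> z \<in> V"
    using P(2) by auto
  then have "w \<otimes> z \<in> carrier G - P"
    using P(2) UV(5) z(1) by (auto simp: disjnt_iff)
  then have "f P (w \<otimes> z) = 0"
    using f(2) P(1) by blast
  then show False
    using w(2) z(2)[OF P(1) wc(1)] by simp
qed

text \<open>The separating family consists of bump functions on the members of the \<open>\<pi>\<close>-base, composed
  with left shifts by a countable dense set of center elements. Restricting to the center makes these
  functions continuous, and density recovers the values at all left translates.\<close>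

theorem countable_pi_base_at_one_imp_metrizable:
  assumes \<P>: "countable \<P>" "pi_base_at X \<one> \<P>"
  shows "metrizable_space X"
proof -
  obtain H where H: "H \<subseteq> topological_center G X" "countable H" "X closure_of H = topspace X"
    using countable_dense_subset_of_center[OF \<P>] by blast
  have bump: "\<exists>f. continuous_map X euclideanreal f \<and> (\<exists>w\<in>P. f w \<noteq> 0) \<and> (\<forall>g\<in>carrier G - P. f g = 0)"
    if "P \<in> \<P>" for P
  proof -
    have P: "openin X P" "P \<noteq> {}"
      using \<P>(2) that by (auto simp: pi_base_at_def)
    then obtain w where w: "w \<in> P"
      by blast
    obtain g where g: "continuous_map X euclideanreal g" "g w = 0" "\<forall>x\<in>topspace X - P. g x = 1"
      using point_open_separating_function[OF compact Hausdorff P(1) w] by blast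
    then have "continuous_map X euclideanreal (\<lambda>x. 1 - g x)"
      by (intro continuous_map_diff) auto
    then show ?thesis
      using g w
      by (intro exI[of _ "\<lambda>x. 1 - g x"] conjI bexI[of _ w]) (auto simp: topspace_eq_carrier)
  qed
  then obtain f where f: "\<And>P. P \<in> \<P> \<Longrightarrow> continuous_map X euclideanreal (f P)"
      "\<And>P. P \<in> \<P> \<Longrightarrow> \<exists>w\<in>P. f P w \<noteq> 0"
      "\<And>P g. P \<in> \<P> \<Longrightarrow> g \<in> carrier G - P \<Longrightarrow> f P g = 0"
    by metis
  have "\<P> \<noteq> {}" "H \<noteq> {}"
    using \<P>(2) openin_topspace[of X] H(3) topspace_eq_carrier one_closed
    unfolding pi_base_at_def by fastforce+
  define B where "B n = from_nat_into \<P> n" for n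
  define l where "l n = from_nat_into H n" for n
  have B: "B n \<in> \<P>" and l: "l n \<in> H" for n
    using \<open>\<P> \<noteq> {}\<close> \<open>H \<noteq> {}\<close> by (simp_all add: B_def l_def from_nat_into)
  show ?thesis
  proof (rule metrizable_space_of_countable_separating_family[
        of X "\<lambda>(n, m) h. f (B n) (l m \<otimes> h)"])
    show "compact_space X"
      by (rule compact)
    show "continuous_map X euclideanreal (case i of (n, m) \<Rightarrow> \<lambda>h. f (B n) (l m \<otimes> h))" for i
    proof -
      obtain n m where i: "i = (n, m)"
        by fastforce
      have "continuous_map X X (\<lambda>h. l m \<otimes> h)"
        using continuous_left_shift l H(1) by blast
      then show ?thesis
        using continuous_map_compose[OF _ f(1)[OF B], of X "\<lambda>h. l m \<otimes> h" n] by (simp add: i o_def)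
    qed
    fix x y
    assume xy_top: "x \<in> topspace X" "y \<in> topspace X"
      and eq: "\<And>i. (case i of (n, m) \<Rightarrow> \<lambda>h. f (B n) (l m \<otimes> h)) x =
                   (case i of (n, m) \<Rightarrow> \<lambda>h. f (B n) (l m \<otimes> h)) y"
    have xy: "x \<in> carrier G" "y \<in> carrier G"
      using xy_top by (simp_all add: topspace_eq_carrier)
    have eqH: "f P (k \<otimes> x) = f P (k \<otimes> y)" if Pk: "P \<in> \<P>" "k \<in> H" for P k
    proof -
      obtain n where "B n = P"
        using from_nat_into_surj[OF \<P>(1) Pk(1)] by (auto simp: B_def)
      moreover obtain m where "l m = k"
        using from_nat_into_surj[OF H(2) Pk(2)] by (auto simp: l_def)
      ultimately show ?thesis
        using eq[of "(n, m)"] by simp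
    qed
    \<comment> \<open>Both sides are continuous in \<open>g\<close>, since only right shifts occur, and they agree on \<open>H\<close>.\<close>
    have eqG: "f P (g \<otimes> x) = f P (g \<otimes> y)" if P: "P \<in> \<P>" and g: "g \<in> carrier G" for P g
    proof (rule forall_in_closure_of[of g X H])
      show "g \<in> X closure_of H"
        using g H(3) by (simp add: topspace_eq_carrier)
      have "continuous_map X euclideanreal (\<lambda>g. f P (g \<otimes> x))"
        "continuous_map X euclideanreal (\<lambda>g. f P (g \<otimes> y))"
        using continuous_map_compose[OF continuous_right_shift f(1)[OF P]] xy by (simp_all add: o_def)
      then have "continuous_map X euclideanreal (\<lambda>g. f P (g \<otimes> x) - f P (g \<otimes> y))"
        by (rule continuous_map_diff)
      from closedin_continuous_map_preimage[OF this, of "{0}"]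
      show "closedin X {g \<in> topspace X. f P (g \<otimes> x) = f P (g \<otimes> y)}"
        by simp
    qed (use eqH P in auto)
    have "inv x \<otimes> y = \<one>"
    proof (rule eq_one_of_invariance[OF \<P>(2) f(2,3)])
      fix P g assume P: "P \<in> \<P>" and g: "g \<in> carrier G"
      show "f P (g \<otimes> (inv x \<otimes> y)) = f P g"
        using eqG[OF P, of "g \<otimes> inv x"] g xy by (simp add: m_assoc)
    qed (use xy in auto)
    then have "x \<otimes> (inv x \<otimes> y) = x"
      using xy by simp
    then show "x = y"
      using xy by (simp add: m_assoc[symmetric])
  qed
qed

end

theorem corollary1:
  fixes G :: "('a, 'b) monoid_scheme" and X :: "'a topology"
  assumes "CHART_group G X"
  shows "(metrizable_space X \<longleftrightarrow> first_countable X) \<and>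
         (first_countable X \<longleftrightarrow> Frechet_space X) \<and>
         (Frechet_space X \<longleftrightarrow> countable_tightness X) \<and>
         (countable_tightness X \<longleftrightarrow> countable_pi_character X)"
proof -
  interpret CHART_group G X
    by (rule assms)
  have "metrizable_space X" if "countable_pi_character X"
    using that one_closed countable_pi_base_at_one_imp_metrizable
    unfolding countable_pi_character_def topspace_eq_carrier by blast
  then show ?thesis
    using metrizable_imp_first_countable first_countable_imp_Frechet_space
      Frechet_space_imp_countable_tightness
      countable_tightness_imp_countable_pi_character[OF compact Hausdorff]
    by blast
qed

end
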